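(* In the codimension-one setting described in the context, $$\mathrm{vol}(A)=\max\Big\{\sum_{i=1}^k \ell_i,\ \sum_{j=k+1}^n \ell_j\Big\}.$$
   Context: Setting: $A=\{\mathbf{a}_1,\dots,\mathbf{a}_n\}\subseteq\mathbb{Z}^d$, and $V\subseteq\mathbb{R}^d$ is the real span of $A$. It is assumed that $\dim V=n-1$ and that each subset of $A$ of cardinality $n-1$ is linearly independent. The lattice of integer relations on $A$ then has rank one and is generated by a single relation $\sum_{i=1}^k \ell_i\mathbf{a}_i-\sum_{j=k+1}^n\ell_j\mathbf{a}_j=\mathbf{0}$, where $1\le k\le n$ and $\ell_1,\dots,\ell_n$ are relatively prime positive integers (an empty sum is $0$). $\Delta(A)\subseteq V$ is the convex hull of $A\cup\{\mathbf{0}\}$ and $\mathbb{Z}A\subseteq V$ is the abelian group generated by $A$. $\mathrm{vol}(A)$ is the volume of $\Delta(A)$ with respect to Lebesgue measure on $V$, normalized so that a simplex which is the convex hull of the origin and a basis of $\mathbb{Z}A$ has volume $1$. *)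

theory Defs
  imports "HOL-Analysis.Analysis" "HOL-Computational_Algebra.Group_Closure"
begin

definition orthonormal_basis_of :: "'a::euclidean_space set \<Rightarrow> 'a set \<Rightarrow> bool" where
  "orthonormal_basis_of V B \<longleftrightarrow>
     B \<subseteq> V \<and> pairwise orthogonal B \<and> (\<forall>b\<in>B. norm b = 1) \<and> span B = V"

(* Lebesgue measure on a linear subspace V, regarded as a Borel measure on the ambient space
   that is concentrated on V: the image of the product Lebesgue measure under orthonormal
   coordinates.  By rotation invariance it does not depend on the orthonormal basis chosen. *)
definition subspace_lborel :: "'a::euclidean_space set \<Rightarrow> 'a measure" where
  "subspace_lborel V =
     (let B = (SOME B. orthonormal_basis_of V B)
      in distr (PiM B (\<lambda>_. lborel)) borel (\<lambda>c. \<Sum>b\<in>B. c b *\<^sub>R b))"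

definition lattice_basis :: "'a::real_vector set \<Rightarrow> 'a set \<Rightarrow> bool" where
  "lattice_basis L B \<longleftrightarrow>
     finite B \<and> group_closure B = L \<and>
     (\<forall>c :: 'a \<Rightarrow> int. (\<Sum>b\<in>B. of_int (c b) *\<^sub>R b) = 0 \<longrightarrow> (\<forall>b\<in>B. c b = 0))"

(* Volume of conv (A \<union> {0}) in the span of A, in units of the simplex spanned by the origin and
   a basis of the lattice generated by A.  When that lattice is discrete (e.g. A consists of
   integer vectors) a basis exists, is a basis of span A, and all choices give the same value. *)
definition normalized_vol :: "'a::euclidean_space set \<Rightarrow> real" where
  "normalized_vol A =
     measure (subspace_lborel (span A)) (convex hull (insert 0 A)) /
     measure (subspace_lborel (span A))
       (convex hull (insert 0 (SOME B. lattice_basis (group_closure A) B)))"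

lemma orthonormal_basis_of_exists:
  assumes "subspace V"
  shows "\<exists>B. orthonormal_basis_of V B"
  using orthonormal_basis_subspace[OF assms] unfolding orthonormal_basis_of_def by metis

end

theory Submission
  imports Defs
begin

text \<open>Write the relation as $\sum c_i a_i = 0$, with $c_i = \ell_i$ for $i \le k$ and $c_i = -\ell_i$
otherwise. Possibly after a change of sign, $\sum c_i \ge 0$. Then the convex hull of \<open>A\<close> and the
origin is the union of the simplices $\sigma_j$ with $c_j > 0$, where $\sigma_j$ is spanned by the
origin and all $a_i$ with $i \ne j$ (\<open>convex_hull_circuit\<close>): subtracting a multiple of the
relation removes some $a_j$ from a convex combination without increasing its coefficient sum. Any
two of these simplices meet in a set of lower dimension (\<open>simplices_overlap\<close>). So the theorem
amounts to the normalized volume of $\sigma_j$ being $|c_j|$.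

By Cramer's rule the volumes of the $\sigma_j$ are proportional to $|c_j|$ (\<open>vol_facet_ratio\<close>),
say $|c_j| \kappa$. That \<open>\<kappa>\<close> is the volume of the simplex of a lattice basis
(\<open>vol_lattice_basis\<close>) follows from the multilinearity of the determinant: the determinants of
tuples from \<open>A\<close> and of tuples from a lattice basis generate the same subgroup of the reals, and coprimality of the $c_j$ identifies the generator of that
subgroup.

The normalization refers to a lattice basis that is merely chosen. One exists by Euclid's
algorithm applied to the relation (\<open>fewer_generators\<close>), and any such basis is a basis of the real
span because \<open>A\<close> consists of integer vectors (\<open>lattice_basis_independent\<close>). To have determinants
and Lebesgue measure available on the span, whose dimension is a number rather than a type, every
set in it is replaced by the prism over it with unit cube fibres in a space with more coordinates
(\<open>subspace_measure_prism\<close>).\<close>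

section \<open>Lattice bases\<close>

lemma group_closure_minimal:
  assumes "X \<subseteq> group_closure Y"
  shows "group_closure X \<subseteq> group_closure Y"
proof
  fix x assume "x \<in> group_closure X"
  then show "x \<in> group_closure Y"
    by (induction rule: group_closure.induct) (use assms in \<open>auto intro: group_closure.diff\<close>)
qed

lemma subset_group_closure: "X \<subseteq> group_closure X"
  by (auto intro: group_closure.base)

lemma span_group_closure: "span (group_closure X) = span (X :: 'a::real_vector set)"
proof
  have "group_closure X \<subseteq> span X"
  proof
    fix x assume "x \<in> group_closure X"
    then show "x \<in> span X"
      by (induction rule: group_closure.induct) (auto simp: span_base span_zero span_diff)
  qed
  then show "span (group_closure X) \<subseteq> span X"
    by (meson span_minimal subspace_span)
qed (simp add: span_mono subset_group_closure)

lemma group_closure_drop_zero: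
  assumes "a i = 0" "i \<in> I"
  shows "group_closure (a ` (I - {i})) = group_closure (a ` I)"
proof -
  have "a ` I = insert 0 (a ` (I - {i}))"
    using assms by force
  then show ?thesis by simp
qed

text \<open>Since $c_i a_i + c_j a_j = (c_i \mp c_j) a_i + c_j (a_j \pm a_i)$, subtracting one coefficient of a
relation from another is compensated by changing one generator. Neither the group generated nor the
greatest common divisor changes, so Euclid's algorithm can be run on the coefficients.\<close>
lemma euclid_step:
  fixes a :: "'i \<Rightarrow> 'v::real_vector" and c :: "'i \<Rightarrow> int"
  assumes "finite I" and "i \<in> I" "j \<in> I" "i \<noteq> j"
    and nz: "c i \<noteq> 0" "c j \<noteq> 0" and le: "\<bar>c j\<bar> \<le> \<bar>c i\<bar>"
    and rel: "(\<Sum>m\<in>I. of_int (c m) *\<^sub>R a m) = 0"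
  defines "s \<equiv> sgn (c i) * sgn (c j)"
  defines "c' \<equiv> c(i := c i - s * c j)" and "a' \<equiv> a(j := a j + of_int s *\<^sub>R a i)"
  shows "(\<Sum>m\<in>I. \<bar>c' m\<bar>) < (\<Sum>m\<in>I. \<bar>c m\<bar>)"
    and "Gcd (c' ` I) = Gcd (c ` I)"
    and "(\<Sum>m\<in>I. of_int (c' m) *\<^sub>R a' m) = 0"
    and "group_closure (a' ` I) = group_closure (a ` I)"
proof -
  have s: "s = 1 \<or> s = -1"
    using nz unfolding s_def by (auto simp: sgn_if)
  have lt: "\<bar>c i - s * c j\<bar> < \<bar>c i\<bar>"
    using nz le unfolding s_def by (auto simp: sgn_if split: if_splits)
  show "(\<Sum>m\<in>I. \<bar>c' m\<bar>) < (\<Sum>m\<in>I. \<bar>c m\<bar>)"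
    using assms(1,2) lt by (intro sum_strict_mono_ex1) (auto simp: c'_def)
  have other: "c' m = c m" if "m \<noteq> i" for m
    using that by (simp add: c'_def)
  show "Gcd (c' ` I) = Gcd (c ` I)"
  proof (rule associated_eqI)
    have "Gcd (c' ` I) dvd c' i" "Gcd (c' ` I) dvd c' j"
      using assms(2,3) by auto
    moreover have "c i = c' i + s * c' j"
      using \<open>i \<noteq> j\<close> by (simp add: c'_def)
    ultimately have "Gcd (c' ` I) dvd c i" by simp
    then have "Gcd (c' ` I) dvd c m" if "m \<in> I" for m
      using that other by (cases "m = i") (auto intro: Gcd_dvd simp flip: other)
    then show "Gcd (c' ` I) dvd Gcd (c ` I)" by (auto intro: Gcd_greatest)
    have "Gcd (c ` I) dvd c i - s * c j"
      using assms(2,3) by (intro dvd_diff dvd_mult) auto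
    then show "Gcd (c ` I) dvd Gcd (c' ` I)"
      by (auto intro!: Gcd_greatest simp: c'_def)
  qed simp_all
  have split: "(\<Sum>m\<in>I. f m) = f i + f j + (\<Sum>m\<in>I - {i, j}. f m)" for f :: "'i \<Rightarrow> 'v"
  proof -
    have "sum f I = sum f {i, j} + sum f (I - {i, j})"
      using assms(1-3) by (metis (no_types, lifting) add.commute empty_subsetI insert_subset sum.subset_diff)
    then show ?thesis using \<open>i \<noteq> j\<close> by simp
  qed
  have "(\<Sum>m\<in>I. of_int (c' m) *\<^sub>R a' m) = (\<Sum>m\<in>I. of_int (c m) *\<^sub>R a m)"
    using \<open>i \<noteq> j\<close> by (subst (1 2) split) (simp add: c'_def a'_def algebra_simps)
  then show "(\<Sum>m\<in>I. of_int (c' m) *\<^sub>R a' m) = 0" using rel by simp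
  have sub: "group_closure (f(j := f j + of_int t *\<^sub>R f i) ` I) \<subseteq> group_closure (f ` I)"
    if "t = 1 \<or> t = -1" for f :: "'i \<Rightarrow> 'v" and t :: int
  proof (rule group_closure_minimal)
    have mem: "f m \<in> group_closure (f ` I)" if "m \<in> I" for m
      using that by (auto intro: group_closure.base)
    have "f j + of_int t *\<^sub>R f i \<in> group_closure (f ` I)"
      using that mem assms(2,3) by (auto intro: group_closure_add group_closure.diff)
    then show "f(j := f j + of_int t *\<^sub>R f i) ` I \<subseteq> group_closure (f ` I)"
      using mem by auto
  qed
  have "a'(j := a' j + of_int (- s) *\<^sub>R a' i) = a"
    using \<open>i \<noteq> j\<close> by (auto simp: a'_def)
  moreover have "- s = 1 \<or> - s = -1" using s by auto
  ultimately have "group_closure (a ` I) \<subseteq> group_closure (a' ` I)"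
    using sub[of "- s" a'] by simp
  then show "group_closure (a' ` I) = group_closure (a ` I)"
    using sub[OF s, of a] unfolding a'_def[symmetric] by (rule subset_antisym[rotated])
qed

text \<open>Euclid's algorithm ends in a relation with a single nonzero coefficient. By primitivity it is
\<open>1\<close> or \<open>-1\<close>, so the corresponding generator has become \<open>0\<close> and can be dropped.\<close>
lemma fewer_generators:
  fixes a :: "'i \<Rightarrow> 'v::real_vector" and c :: "'i \<Rightarrow> int"
  assumes "finite I" and "Gcd (c ` I) = 1"
    and "(\<Sum>m\<in>I. of_int (c m) *\<^sub>R a m) = 0"
  shows "\<exists>B. finite B \<and> card B < card I \<and> group_closure B = group_closure (a ` I)"
  using assms(2,3)
proof (induction "nat (\<Sum>m\<in>I. \<bar>c m\<bar>)" arbitrary: a c rule: less_induct)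
  case less
  show ?case
  proof (cases "\<exists>i\<in>I. \<exists>j\<in>I. i \<noteq> j \<and> c i \<noteq> 0 \<and> c j \<noteq> 0")
    case True
    then obtain i j where ij: "i \<in> I" "j \<in> I" "i \<noteq> j" "c i \<noteq> 0" "c j \<noteq> 0" "\<bar>c j\<bar> \<le> \<bar>c i\<bar>"
      by (metis linorder_le_cases[of "\<bar>c _\<bar>" "\<bar>c _\<bar>"])
    note step = euclid_step[OF assms(1) ij less.prems(2)]
    let ?c = "c(i := c i - sgn (c i) * sgn (c j) * c j)"
    have "0 \<le> (\<Sum>m\<in>I. \<bar>?c m\<bar>)"
      by (rule sum_nonneg) simp
    then have "nat (\<Sum>m\<in>I. \<bar>?c m\<bar>) < nat (\<Sum>m\<in>I. \<bar>c m\<bar>)"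
      using step(1) by linarith
    from less.hyps[OF this _ step(3)] show ?thesis
      unfolding step(2,4) using less.prems(1) by blast
  next
    case False
    obtain i where i: "i \<in> I" "c i \<noteq> 0"
    proof -
      have "\<exists>i\<in>I. c i \<noteq> 0"
      proof (rule ccontr)
        assume "\<not> ?thesis"
        then have "Gcd (c ` I) = 0" by auto
        then show False using less.prems(1) by simp
      qed
      then show ?thesis using that by blast
    qed
    have 0: "c m = 0" if "m \<in> I" "m \<noteq> i" for m
      using False i that by blast
    have "\<bar>c i\<bar> dvd Gcd (c ` I)"
      by (rule Gcd_greatest) (use 0 i in \<open>auto, metis dvd_0_right dvd_refl\<close>)
    then have "\<bar>c i\<bar> = 1" using less.prems(1) by simp
    have "(\<Sum>m\<in>I. of_int (c m) *\<^sub>R a m) = of_int (c i) *\<^sub>R a i"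
      using assms(1) i 0 by (subst sum.remove[of _ i]) (auto intro: sum.neutral)
    then have "a i = 0" using less.prems(2) i by simp
    then have "group_closure (a ` (I - {i})) = group_closure (a ` I)"
      using i(1) by (rule group_closure_drop_zero)
    moreover have "card (a ` (I - {i})) < card I"
      using assms(1) i(1) card_image_le[of "I - {i}" a] card_Diff1_less[of I i] by simp
    ultimately show ?thesis using assms(1) by (intro exI[of _ "a ` (I - {i})"]) simp
  qed
qed

text \<open>The reals are a vector space over the rationals, hence have a rational coordinate functional.\<close>
lemma rational_functional:
  fixes r :: real
  assumes "r \<noteq> 0"
  shows "\<exists>g :: real \<Rightarrow> rat. (\<forall>x y. g (x + y) = g x + g y) \<and>
    (\<forall>q x. g (of_rat q * x) = q * g x) \<and> g r = 1"
proof -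
  interpret vector_space_pair "\<lambda>q x. of_rat q * x :: real" "\<lambda>q x. q * x :: rat"
    by unfold_locales (auto simp: algebra_simps of_rat_add of_rat_mult)
  have "vs1.independent {r}"
    using assms by simp
  from linear_independent_extend[OF this, of "\<lambda>_. 1"]
  obtain g where g: "Vector_Spaces.linear (\<lambda>q x. of_rat q * x :: real) (\<lambda>q x. q * x :: rat) g" "g r = 1"
    by auto
  interpret g: Vector_Spaces.linear "\<lambda>q x. of_rat q * x :: real" "\<lambda>q x. q * x :: rat" g
    by (rule g(1))
  show ?thesis
    using g.add g.scale g(2) by blast
qed

text \<open>A basis of a lattice of integer vectors is independent over the reals, not only over the integers:
a \<open>\<rat>\<close>-linear functional \<open>g\<close> with \<open>g r \<noteq> 0\<close> for one coefficient \<open>r\<close> turns a real relation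
into a nontrivial rational one, because the coordinates of the vectors are rational; clearing
denominators makes it an integer relation. For general lattices the claim would be false, for
example for the basis \<open>1\<close>, \<open>sqrt 2\<close> of a subgroup of the line.\<close>
lemma lattice_basis_independent:
  fixes B :: "(real ^ 'd) set"
  assumes B: "lattice_basis L B"
    and int: "\<forall>b\<in>B. \<forall>j. b $ j \<in> \<int>"
  shows "independent B"
proof (rule ccontr)
  assume "\<not> independent B"
  moreover have fin: "finite B" using B by (simp add: lattice_basis_def)
  ultimately obtain u b0 where u: "(\<Sum>b\<in>B. u b *\<^sub>R b) = 0" "b0 \<in> B" "u b0 \<noteq> 0"
    using dependent_finite by blast
  obtain g :: "real \<Rightarrow> rat" where add: "\<And>x y. g (x + y) = g x + g y"
    and mul: "\<And>q x. g (of_rat q * x) = q * g x" and g1: "g (u b0) = 1"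
    using rational_functional[OF u(3)] by blast
  have g0: "g 0 = 0" using mul[of 0 0] by simp
  have gsum: "g (sum f X) = (\<Sum>x\<in>X. g (f x))" if "finite X" for f :: "real^'d \<Rightarrow> real" and X
    using that by induction (auto simp: g0 add)
  have q: "(\<Sum>b\<in>B. of_rat (g (u b)) *\<^sub>R b) = 0"
  proof (rule vec_eq_iff[THEN iffD2], rule allI)
    fix j
    have "(\<Sum>b\<in>B. u b * b $ j) = (\<Sum>b\<in>B. u b *\<^sub>R b) $ j"
      by simp
    then have "0 = g (\<Sum>b\<in>B. u b * b $ j)" using u(1) g0 by simp
    also have "\<dots> = (\<Sum>b\<in>B. g (u b * b $ j))" by (rule gsum[OF fin])
    also have "\<dots> = (\<Sum>b\<in>B. of_int \<lfloor>b $ j\<rfloor> * g (u b))"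
    proof (rule sum.cong[OF refl])
      fix b assume "b \<in> B"
      then have "u b * b $ j = of_rat (of_int \<lfloor>b $ j\<rfloor>) * u b"
        using int by (simp add: of_int_floor)
      then show "g (u b * b $ j) = of_int \<lfloor>b $ j\<rfloor> * g (u b)" by (metis mul)
    qed
    finally have "0 = (of_rat (\<Sum>b\<in>B. of_int \<lfloor>b $ j\<rfloor> * g (u b)) :: real)" by simp
    also have "\<dots> = (\<Sum>b\<in>B. of_rat (g (u b)) *\<^sub>R b) $ j"
      using int by (auto simp: of_rat_sum of_rat_mult mult.commute of_int_floor intro!: sum.cong)
    finally show "(\<Sum>b\<in>B. of_rat (g (u b)) *\<^sub>R b) $ j = 0 $ j" by simp
  qed
  define D where "D = (\<Prod>b\<in>B. snd (quotient_of (g (u b))))"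
  have Dpos: "D > 0" unfolding D_def by (auto intro: prod_pos quotient_of_denom_pos')
  have "\<exists>m::int. of_int m = of_int D * g (u b)" if "b \<in> B" for b
  proof -
    have "D = snd (quotient_of (g (u b))) * (\<Prod>b\<in>B - {b}. snd (quotient_of (g (u b))))"
      unfolding D_def by (rule prod.remove[OF fin that])
    then obtain k where k: "D = snd (quotient_of (g (u b))) * k" by blast
    obtain x y where xy: "quotient_of (g (u b)) = (x, y)" by fastforce
    then have "g (u b) = of_int x / of_int y" "y > 0"
      by (rule quotient_of_div, rule quotient_of_denom_pos)
    then have "of_int D * g (u b) = of_int (x * k)"
      using k xy by simp
    then show ?thesis by metis
  qed
  then obtain m where m: "\<And>b. b \<in> B \<Longrightarrow> of_int (m b) = of_int D * g (u b)" by metis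
  have m': "real_of_int (m b) = of_int D * of_rat (g (u b))" if "b \<in> B" for b
    using arg_cong[OF m[OF that], of "of_rat :: rat \<Rightarrow> real"] by (simp add: of_rat_mult)
  have "(\<Sum>b\<in>B. of_int (m b) *\<^sub>R b) = of_int D *\<^sub>R (\<Sum>b\<in>B. of_rat (g (u b)) *\<^sub>R b)"
    using m' by (simp add: scaleR_sum_right)
  then have "(\<Sum>b\<in>B. of_int (m b) *\<^sub>R b) = 0" using q by simp
  then have "m b0 = 0" using B u(2) by (auto simp: lattice_basis_def)
  then show False using m[OF u(2)] g1 Dpos by simp
qed

lemma independent_imp_lattice_basis:
  assumes "independent B" "finite B"
  shows "lattice_basis (group_closure B) B"
proof -
  have "c b = 0" if "(\<Sum>b\<in>B. of_int (c b) *\<^sub>R b) = 0" "b \<in> B" for c :: "'a \<Rightarrow> int" and b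
    using independentD[OF assms subset_refl that] by simp
  then show ?thesis
    using assms(2) by (auto simp: lattice_basis_def)
qed

section \<open>Lebesgue measure on a subspace\<close>

text \<open>Only some of the coordinates of the source space are matched with the given orthonormal
vectors; the remaining ones are confined to \<open>[0, 1]\<close> and contribute a factor \<open>1\<close>. Thus a
measure on a subspace becomes ordinary Lebesgue measure, on any space with enough coordinates.\<close>
lemma emeasure_coordinates:
  fixes h :: "'c::euclidean_space \<Rightarrow> 'a::euclidean_space"
  assumes K: "K \<subseteq> Basis" and h: "bij_betw h K B" and S: "S \<in> sets borel"
  shows "emeasure (distr (PiM B (\<lambda>_. lborel)) borel (\<lambda>c. \<Sum>b\<in>B. c b *\<^sub>R b)) S =
    emeasure lborel {y. (\<Sum>k\<in>K. (y \<bullet> k) *\<^sub>R h k) \<in> S \<and> (\<forall>k\<in>Basis - K. 0 \<le> y \<bullet> k \<and> y \<bullet> k \<le> 1)}"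
    (is "?L = emeasure lborel ?Z")
proof -
  interpret product_sigma_finite "\<lambda>_. lborel :: real measure" by standard
  have fin: "finite K" "finite (Basis - K)" "finite B"
    using K h finite_subset[OF K] bij_betw_finite by auto
  define g :: "('c \<Rightarrow> real) \<Rightarrow> 'a" where "g = (\<lambda>d. \<Sum>k\<in>K. d k *\<^sub>R h k)"
  define \<rho> :: "('a \<Rightarrow> real) \<Rightarrow> 'c \<Rightarrow> real" where "\<rho> = (\<lambda>c. \<lambda>k\<in>K. c (h k))"
  let ?MK = "PiM K (\<lambda>_. lborel :: real measure)"
  let ?MN = "PiM (Basis - K) (\<lambda>_. lborel :: real measure)"
  let ?MB = "PiM B (\<lambda>_. lborel :: real measure)"
  have hB: "h k \<in> B" if "k \<in> K" for k
    using h that by (auto simp: bij_betw_def)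
  have [measurable]: "\<rho> \<in> measurable ?MB ?MK"
    unfolding \<rho>_def by (intro measurable_restrict measurable_component_singleton hB)
  have [measurable]: "g \<in> measurable ?MK borel"
    unfolding g_def by measurable
  have reindex: "distr ?MB ?MK \<rho> = ?MK"
  proof (rule PiM_eqI[OF fin(1)])
    fix A :: "'c \<Rightarrow> real set" assume A: "\<And>i. i \<in> K \<Longrightarrow> A i \<in> sets lborel"
    define h' where "h' = the_inv_into K h"
    have h': "h' (h k) = k" if "k \<in> K" for k
      using h that by (auto simp: h'_def bij_betw_def the_inv_into_f_f)
    have h'K: "h' b \<in> K" "h (h' b) = b" if "b \<in> B" for b
      using h that h' by (auto simp: bij_betw_def)
    have "\<rho> -` Pi\<^sub>E K A \<inter> space ?MB = Pi\<^sub>E B (A \<circ> h')"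
    proof (intro set_eqI iffI)
      fix c assume "c \<in> \<rho> -` Pi\<^sub>E K A \<inter> space ?MB"
      then have *: "\<rho> c \<in> Pi\<^sub>E K A" "c \<in> extensional B" by (auto simp: space_PiM PiE_def)
      have "c b \<in> A (h' b)" if "b \<in> B" for b
        using PiE_mem[OF *(1) h'K(1)[OF that]] h'K[OF that] by (simp add: \<rho>_def)
      then show "c \<in> Pi\<^sub>E B (A \<circ> h')" using *(2) by (auto simp: PiE_def)
    next
      fix c assume *: "c \<in> Pi\<^sub>E B (A \<circ> h')"
      then have "c (h k) \<in> A k" if "k \<in> K" for k
        using PiE_mem[OF * hB[OF that]] h'[OF that] by simp
      then show "c \<in> \<rho> -` Pi\<^sub>E K A \<inter> space ?MB"
        using * by (auto simp: \<rho>_def space_PiM PiE_def)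
    qed
    then have "emeasure (distr ?MB ?MK \<rho>) (Pi\<^sub>E K A) = emeasure ?MB (Pi\<^sub>E B (A \<circ> h'))"
      using A fin sets_PiM_I_finite[of K A "\<lambda>_. lborel"] by (subst emeasure_distr) simp_all
    also have "\<dots> = (\<Prod>b\<in>B. emeasure lborel ((A \<circ> h') b))"
      using A h'K fin by (intro emeasure_PiM) auto
    also have "\<dots> = (\<Prod>k\<in>K. emeasure lborel (A k))"
      by (subst prod.reindex_bij_betw[OF h, symmetric]) (simp add: h')
    finally show "emeasure (distr ?MB ?MK \<rho>) (Pi\<^sub>E K A) = (\<Prod>k\<in>K. emeasure lborel (A k))" .
  qed simp
  define X where "X = g -` S \<inter> space ?MK"
  define Y :: "('c \<Rightarrow> real) set" where "Y = Pi\<^sub>E (Basis - K) (\<lambda>_. {0..1})"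
  have XY: "X \<in> sets ?MK" "Y \<in> sets ?MN"
    using S fin unfolding X_def Y_def by (auto intro!: sets_PiM_I_finite)
  have "(\<lambda>c. \<Sum>b\<in>B. c b *\<^sub>R b) = (\<lambda>c. g (\<rho> c))"
    by (auto simp: g_def \<rho>_def sum.reindex_bij_betw[OF h, symmetric] cong: sum.cong)
  then have "?L = emeasure (distr ?MB borel (g \<circ> \<rho>)) S" by (simp add: comp_def)
  also have "distr ?MB borel (g \<circ> \<rho>) = distr ?MK borel g"
    by (subst distr_distr[symmetric, of g ?MK]) (auto simp: reindex)
  also have "emeasure (distr ?MK borel g) S = emeasure ?MK X"
    unfolding X_def using S by (intro emeasure_distr) auto
  finally have L: "?L = emeasure ?MK X" .
  let ?f = "\<lambda>f. \<Sum>b\<in>Basis. f b *\<^sub>R b :: 'c"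
  let ?M = "PiM Basis (\<lambda>_. lborel :: real measure)"
  have f[measurable]: "?f \<in> measurable ?M borel" by measurable
  have [measurable]: "(\<lambda>y::'c. \<Sum>k\<in>K. (y \<bullet> k) *\<^sub>R h k) \<in> measurable borel borel"
    by measurable
  have "?Z = ((\<lambda>y::'c. \<Sum>k\<in>K. (y \<bullet> k) *\<^sub>R h k) -` S \<inter> space borel) \<inter>
      (\<Inter>k\<in>Basis - K. {y. 0 \<le> y \<bullet> k \<and> y \<bullet> k \<le> 1})"
    by auto
  also have "\<dots> \<in> sets borel"
  proof (cases "Basis - K = {}")
    case True
    have "(\<lambda>y::'c. \<Sum>k\<in>K. (y \<bullet> k) *\<^sub>R h k) -` S \<inter> space borel \<in> sets borel"
      by (rule measurable_sets[OF _ S]) measurable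
    then show ?thesis unfolding True by simp
  next
    case False
    show ?thesis
      by (intro sets.Int measurable_sets[OF _ S] sets.finite_INT False fin) measurable
  qed
  finally have Z[measurable]: "?Z \<in> sets borel" .
  have coord: "?f d \<bullet> k = d k" if "k \<in> Basis" for d k
    using that by (simp add: inner_sum_left inner_Basis if_distrib sum.delta cong: if_cong)
  have "emeasure lborel ?Z = emeasure (distr ?M borel ?f) ?Z"
    by (rule arg_cong[OF lborel_eq, of "\<lambda>M. emeasure M ?Z"])
  also have "\<dots> = emeasure ?M (?f -` ?Z \<inter> space ?M)"
    using Z by (intro emeasure_distr) auto
  finally have Z1: "emeasure lborel ?Z = emeasure ?M (?f -` ?Z \<inter> space ?M)" .
  have merge: "?M = distr (?MK \<Otimes>\<^sub>M ?MN) (PiM (K \<union> (Basis - K)) (\<lambda>_. lborel)) (merge K (Basis - K))"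
    using K by (subst distr_merge) (auto simp: fin Un_absorb1)
  have Z2: "emeasure (distr (?MK \<Otimes>\<^sub>M ?MN) (PiM (K \<union> (Basis - K)) (\<lambda>_. lborel)) (merge K (Basis - K)))
        (?f -` ?Z \<inter> space ?M) =
      emeasure (?MK \<Otimes>\<^sub>M ?MN) (merge K (Basis - K) -` (?f -` ?Z \<inter> space ?M) \<inter> space (?MK \<Otimes>\<^sub>M ?MN))"
    using K measurable_sets[OF f, of ?Z] Z
    by (intro emeasure_distr measurable_merge) (auto simp: Un_absorb1)
  have Z3: "merge K (Basis - K) -` (?f -` ?Z \<inter> space ?M) \<inter> space (?MK \<Otimes>\<^sub>M ?MN) = X \<times> Y"
  proof -
    have mem: "merge K (Basis - K) (d, d') \<in> ?f -` ?Z \<inter> space ?M \<longleftrightarrow> d \<in> X \<and> d' \<in> Y"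
      if d: "d \<in> space ?MK" "d' \<in> space ?MN" for d d'
    proof -
      let ?m = "merge K (Basis - K) (d, d')"
      have "?m \<in> space ?M"
        using K d by (auto simp: space_PiM PiE_def extensional_def merge_def)
      moreover have "(\<Sum>k\<in>K. (?f ?m \<bullet> k) *\<^sub>R h k) = g d"
        unfolding g_def by (rule sum.cong[OF refl]) (use K coord in \<open>auto simp: merge_def\<close>)
      moreover have "?f ?m \<bullet> k = d' k" if "k \<in> Basis - K" for k
        using that coord by (auto simp: merge_def)
      moreover have "d' \<in> Y \<longleftrightarrow> (\<forall>k\<in>Basis - K. 0 \<le> d' k \<and> d' k \<le> 1)"
        using d(2) by (auto simp: Y_def space_PiM PiE_def Pi_def)
      ultimately show ?thesis
        using d(1) by (auto simp: X_def)
    qed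
    have sub: "X \<subseteq> space ?MK" "Y \<subseteq> space ?MN"
      using XY[THEN sets.sets_into_space] .
    show ?thesis
    proof (rule set_eqI)
      fix z :: "('c \<Rightarrow> real) \<times> ('c \<Rightarrow> real)"
      obtain d d' where z: "z = (d, d')" by fastforce
      show "z \<in> merge K (Basis - K) -` (?f -` ?Z \<inter> space ?M) \<inter> space (?MK \<Otimes>\<^sub>M ?MN) \<longleftrightarrow> z \<in> X \<times> Y"
        unfolding z Int_iff[of _ "merge K (Basis - K) -` _"] vimage_eq[of _ "merge K (Basis - K)"]
          space_pair_measure mem_Sigma_iff
        using mem[of d d'] sub by blast
    qed
  qed
  have Z4: "emeasure (?MK \<Otimes>\<^sub>M ?MN) (X \<times> Y) = emeasure ?MK X * emeasure ?MN Y"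
  proof -
    interpret N: finite_product_sigma_finite "\<lambda>_. lborel :: real measure" "Basis - K"
      by standard (rule fin)
    show ?thesis using XY by (rule N.emeasure_pair_measure_Times)
  qed
  have Y1: "emeasure ?MN Y = 1"
    unfolding Y_def using fin by (subst emeasure_PiM) auto
  have "emeasure lborel ?Z = emeasure ?MK X"
    using Z1 Z2[folded merge] unfolding Z3 Z4 Y1 by simp
  then show ?thesis using L by simp
qed

lemma convex_hull_insert_zero_image:
  fixes a :: "'i \<Rightarrow> 'v::real_vector"
  assumes "finite J"
  shows "convex hull (insert 0 (a ` J)) =
    {\<Sum>i\<in>J. u i *\<^sub>R a i | u. (\<forall>i\<in>J. 0 \<le> u i) \<and> sum u J \<le> (1::real)}" (is "_ = ?R")
proof (rule hull_unique)
  show "insert 0 (a ` J) \<subseteq> ?R"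
  proof -
    have "0 \<in> ?R"
      by (rule CollectI, rule exI[of _ "\<lambda>_. 0"]) simp
    moreover have "a j \<in> ?R" if "j \<in> J" for j
    proof (rule CollectI, rule exI[of _ "\<lambda>i. if i = j then 1 else 0"], intro conjI)
      show "a j = (\<Sum>i\<in>J. (if i = j then 1 else 0) *\<^sub>R a i)"
        using assms that by (simp add: if_distrib[of "\<lambda>x. x *\<^sub>R _"] sum.delta cong: if_cong)
    qed (use assms that in auto)
    ultimately show ?thesis by blast
  qed
  show "convex ?R"
  proof (rule convexI)
    fix x y and s t :: real
    assume "x \<in> ?R" "y \<in> ?R" and st: "0 \<le> s" "0 \<le> t" "s + t = 1"
    then obtain u w where u: "x = (\<Sum>i\<in>J. u i *\<^sub>R a i)" "\<forall>i\<in>J. 0 \<le> u i" "sum u J \<le> 1"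
      and w: "y = (\<Sum>i\<in>J. w i *\<^sub>R a i)" "\<forall>i\<in>J. 0 \<le> w i" "sum w J \<le> 1"
      by blast
    have "s * sum u J + t * sum w J \<le> 1"
      using u(3) w(3) st by (intro convex_bound_le) auto
    then show "s *\<^sub>R x + t *\<^sub>R y \<in> ?R"
      using u w st
      by (intro CollectI exI[of _ "\<lambda>i. s * u i + t * w i"])
        (auto simp: scaleR_sum_right sum.distrib sum_distrib_left scaleR_add_left)
  qed
  fix C :: "'v set" assume C: "insert 0 (a ` J) \<subseteq> C" "convex C"
  show "?R \<subseteq> C"
  proof
    fix x assume "x \<in> ?R"
    then obtain u where u: "x = (\<Sum>i\<in>J. u i *\<^sub>R a i)" "\<forall>i\<in>J. 0 \<le> u i" "sum u J \<le> 1"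
      by blast
    show "x \<in> C"
    proof (cases "sum u J = 0")
      case True
      then have "\<forall>i\<in>J. u i = 0" using u(2) assms by (simp add: sum_nonneg_eq_0_iff)
      then have "x = 0" using u(1) by simp
      then show ?thesis using C by simp
    next
      case False
      moreover have "0 \<le> sum u J" using u(2) by (simp add: sum_nonneg)
      ultimately have pos: "0 < sum u J" by simp
      have "(\<Sum>i\<in>J. (u i / sum u J) *\<^sub>R a i) \<in> C"
        using pos u(2) C by (intro convex_sum assms) (auto simp flip: sum_divide_distrib)
      then have "sum u J *\<^sub>R (\<Sum>i\<in>J. (u i / sum u J) *\<^sub>R a i) + (1 - sum u J) *\<^sub>R 0 \<in> C"
        using C pos u(3) by (intro convexD) auto
      moreover have "sum u J *\<^sub>R (\<Sum>i\<in>J. (u i / sum u J) *\<^sub>R a i) = x"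
        using pos u(1) by (simp add: scaleR_sum_right)
      ultimately show ?thesis by simp
    qed
  qed
qed

text \<open>The dimension of \<open>V\<close> is not a type, so \<open>V\<close> is coordinatised by a subset \<open>K\<close> of the index type of
some \<open>real^'m\<close>. The well-ordering of \<open>'m\<close> serves \<open>measure_linear_image\<close>, the formula for the
Lebesgue measure of linear images.\<close>
locale orthonormal_frame =
  fixes V :: "'a::euclidean_space set" and K :: "'m::{finite,wellorder} set" and e :: "'m \<Rightarrow> 'a"
  assumes inj: "inj_on e K" and frame: "orthonormal_basis_of V (e ` K)"
begin

definition emb :: "real^'m::_ \<Rightarrow> 'a" where
  "emb y = (\<Sum>i\<in>K. (y $ i) *\<^sub>R e i)"

definition coord :: "'a \<Rightarrow> real^'m::_" where
  "coord x = (\<chi> i. if i \<in> K then x \<bullet> e i else 0)"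

text \<open>The surplus coordinates fill unit intervals, so that the full-dimensional volume of the prism over
\<open>S\<close> is the volume of \<open>S\<close> inside \<open>V\<close>.\<close>
definition prism :: "'a set \<Rightarrow> (real^'m::_) set" where
  "prism S = {y. emb y \<in> S \<and> (\<forall>i. i \<notin> K \<longrightarrow> 0 \<le> y $ i \<and> y $ i \<le> 1)}"

text \<open>The determinant of a tuple of vectors of \<open>V\<close> in the coordinates of the frame; the identity rows
outside \<open>K\<close> only pad the matrix to full size.\<close>
definition frame_det :: "('m \<Rightarrow> 'a) \<Rightarrow> real" where
  "frame_det v = det (\<chi> i. if i \<in> K then coord (v i) else axis i 1)"

text \<open>The prism over the simplex spanned by the origin and the frame.\<close>
definition unit_prism :: "(real^'m::_) set" where
  "unit_prism = {y. (\<forall>i. 0 \<le> y $ i) \<and> (\<Sum>i\<in>K. y $ i) \<le> 1 \<and> (\<forall>i. i \<notin> K \<longrightarrow> y $ i \<le> 1)}"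

lemma inner_frame: "i \<in> K \<Longrightarrow> j \<in> K \<Longrightarrow> e i \<bullet> e j = (if i = j then 1 else 0)"
  using frame inj_onD[OF inj, of i j] unfolding orthonormal_basis_of_def pairwise_def orthogonal_def
  by (cases "i = j") (auto simp: norm_eq_1)

lemma span_frame: "span (e ` K) = V"
  using frame by (simp add: orthonormal_basis_of_def)

lemma dim_V: "dim V = card K"
proof -
  have "independent (e ` K)"
    using frame unfolding orthonormal_basis_of_def
    by (intro pairwise_orthogonal_independent) auto
  then show ?thesis
    using span_frame inj by (metis card_image dim_eq_card_independent dim_span)
qed

lemma linear_emb: "linear emb"
  unfolding emb_def by (rule linearI) (simp_all add: algebra_simps sum.distrib scaleR_sum_right)

lemma linear_coord: "linear coord"
  unfolding coord_def by (rule linearI) (auto simp: vec_eq_iff inner_add_left)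

lemma emb_inner: "i \<in> K \<Longrightarrow> emb y \<bullet> e i = y $ i"
  unfolding emb_def by (simp add: inner_sum_left inner_frame if_distrib sum.delta cong: if_cong)

lemma coord_emb: "coord (emb y) = (\<chi> i. if i \<in> K then y $ i else 0)"
  by (simp add: coord_def emb_inner vec_eq_iff)

lemma emb_coord: assumes "x \<in> V" shows "emb (coord x) = x"
proof -
  have "(emb \<circ> coord) x = id x"
  proof (rule linear_eq_on_span[where B = "e ` K" and f = "emb \<circ> coord" and g = id])
    show "linear (emb \<circ> coord)" by (rule linear_compose[OF linear_coord linear_emb])
    show "linear (id :: 'a \<Rightarrow> 'a)" by (rule linear_id)
    show "x \<in> span (e ` K)" using assms span_frame by simp
    fix x assume "x \<in> e ` K"
    then show "(emb \<circ> coord) x = id x"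
      by (auto simp: emb_def coord_def inner_frame if_distrib[of "\<lambda>x. x *\<^sub>R _"] sum.delta cong: if_cong)
  qed
  then show ?thesis by simp
qed

lemma compact_prism:
  assumes "compact S"
  shows "compact (prism S)"
proof -
  have "prism S = (emb -` S) \<inter> (\<Inter>i\<in>-K. {y. 0 \<le> y $ i} \<inter> {y. y $ i \<le> 1})"
    by (auto simp: prism_def)
  moreover have "closed (emb -` S)"
    by (intro continuous_closed_vimage compact_imp_closed assms linear_continuous_at
        linear_conv_bounded_linear[THEN iffD1] linear_emb)
  ultimately have "closed (prism S)"
    by (auto intro!: closed_Int closed_INT closed_Collect_le continuous_intros)
  moreover have "bounded (prism S)"
  proof -
    obtain R where R: "\<And>x. x \<in> S \<Longrightarrow> norm x \<le> R"
      using compact_imp_bounded[OF assms] bounded_iff by blast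
    have "norm y \<le> real CARD('m) * (\<bar>R\<bar> + 1)" if "y \<in> prism S" for y
    proof -
      have "\<bar>y $ i\<bar> \<le> \<bar>R\<bar> + 1" for i
      proof (cases "i \<in> K")
        case True
        then have "\<bar>y $ i\<bar> = \<bar>emb y \<bullet> e i\<bar>" by (simp add: emb_inner)
        also have "\<dots> \<le> norm (emb y) * norm (e i)" by (rule Cauchy_Schwarz_ineq2)
        also have "norm (e i) = 1" using inner_frame[OF True True] by (simp add: norm_eq_1)
        finally show ?thesis using R[of "emb y"] that by (auto simp: prism_def)
      next
        case False
        then show ?thesis using that by (auto simp: prism_def)
      qed
      then have "(\<Sum>i\<in>UNIV. \<bar>y $ i\<bar>) \<le> (\<Sum>i\<in>(UNIV::'m set). \<bar>R\<bar> + 1)"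
        by (intro sum_mono)
      then show ?thesis using norm_le_l1_cart[of y] by simp
    qed
    then show ?thesis by (auto intro: boundedI)
  qed
  ultimately show ?thesis by (simp add: compact_eq_bounded_closed)
qed

lemma subspace_measure_prism:
  assumes "e ` K = (SOME B. orthonormal_basis_of V B)" and "compact S"
  shows "measure (subspace_lborel V) S = measure lebesgue (prism S)"
proof -
  let ?K = "(\<lambda>i. axis i (1::real)) ` K"
  have bij: "bij_betw (e \<circ> axis_index) ?K (e ` K)"
    using inj by (auto simp: bij_betw_def inj_on_def image_image)
  have inj_axis: "inj_on (\<lambda>i::'m. axis i (1::real)) X" for X
    by (auto simp: inj_on_def axis_eq_axis)
  have "(\<Sum>k\<in>?K. (y \<bullet> k) *\<^sub>R (e \<circ> axis_index) k) = emb y" for y :: "real^'m::_"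
    by (simp add: sum.reindex[OF inj_axis] emb_def inner_axis)
  moreover have "(\<forall>k\<in>Basis - ?K. 0 \<le> y \<bullet> k \<and> y \<bullet> k \<le> 1) \<longleftrightarrow>
    (\<forall>i. i \<notin> K \<longrightarrow> 0 \<le> y $ i \<and> y $ i \<le> 1)" for y :: "real^'m::_"
  proof -
    have "Basis - ?K = (\<lambda>i. axis i (1::real)) ` (- K)"
      by (auto simp: Basis_vec_def axis_eq_axis)
    then show ?thesis by (auto simp: inner_axis)
  qed
  ultimately have "emeasure (subspace_lborel V) S = emeasure lborel (prism S)"
    using emeasure_coordinates[OF _ bij borel_compact[OF assms(2)]]
    unfolding subspace_lborel_def Let_def assms(1)[symmetric] prism_def
    by (simp add: image_subset_iff)
  then have "measure (subspace_lborel V) S = measure lborel (prism S)"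
    by (simp add: measure_def)
  also have "\<dots> = measure lebesgue (prism S)"
    using borel_compact[OF compact_prism[OF assms(2)]] by (intro measure_completion[symmetric]) simp
  finally show ?thesis .
qed

lemma lmeasurable_unit_prism: "unit_prism \<in> lmeasurable"
  and unit_prism_pos: "0 < measure lebesgue unit_prism"
proof -
  have "unit_prism = (\<Inter>i. {y. 0 \<le> y $ i}) \<inter> {y. (\<Sum>i\<in>K. y $ i) \<le> 1} \<inter> (\<Inter>i\<in>-K. {y. y $ i \<le> 1})"
    by (auto simp: unit_prism_def)
  also have "closed \<dots>"
    by (intro closed_Int closed_INT ballI closed_Collect_le continuous_intros)
  finally have "closed unit_prism" .
  have sub: "unit_prism \<subseteq> cbox 0 1"
  proof
    fix y assume y: "y \<in> unit_prism"
    have "y $ i \<le> 1" for i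
    proof (cases "i \<in> K")
      case True
      then have "y $ i \<le> (\<Sum>i\<in>K. y $ i)"
        using y by (intro member_le_sum) (auto simp: unit_prism_def)
      then show ?thesis using y by (simp add: unit_prism_def)
    qed (use y in \<open>simp add: unit_prism_def\<close>)
    then show "y \<in> cbox 0 1" using y by (simp add: mem_box_cart unit_prism_def)
  qed
  show unit_prism: "unit_prism \<in> lmeasurable"
    using \<open>closed unit_prism\<close> sub bounded_subset[OF bounded_cbox sub]
    by (intro lmeasurable_compact) (simp add: compact_eq_bounded_closed)
  let ?c = "(\<chi> i. 1 / real CARD('m)) :: real^'m::_"
  have "cbox 0 ?c \<subseteq> unit_prism"
  proof
    fix y assume y: "y \<in> cbox 0 ?c"
    have le: "y $ i \<le> 1 / real CARD('m)" "0 \<le> y $ i" for i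
      using y by (auto simp: mem_box_cart)
    have "(\<Sum>i\<in>K. y $ i) \<le> (\<Sum>i\<in>UNIV. y $ i)"
      using le by (intro sum_mono2) auto
    also have "\<dots> \<le> (\<Sum>i\<in>(UNIV::'m set). 1 / real CARD('m))"
      using le by (intro sum_mono)
    also have "\<dots> = 1" by simp
    finally have "(\<Sum>i\<in>K. y $ i) \<le> 1" .
    moreover have "y $ i \<le> 1" for i
      using le(1)[of i] by (rule order_trans) (simp add: field_simps Suc_leI)
    ultimately show "y \<in> unit_prism" using le by (simp add: unit_prism_def)
  qed
  then have "measure lebesgue (cbox 0 ?c) \<le> measure lebesgue unit_prism"
    by (intro measure_mono_fmeasurable unit_prism) auto
  moreover have "0 < measure lebesgue (cbox 0 ?c)"
    by (simp add: content_pos_lt_eq content_cbox_cart interval_eq_empty_cart prod_pos)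
  ultimately show "0 < measure lebesgue unit_prism" by linarith
qed

section \<open>Determinants and volumes of simplices\<close>

lemma linear_frame_det:
  assumes "p \<in> K"
  shows "linear (\<lambda>x. frame_det (v(p := x)))"
proof -
  define r where "r i = (if i \<in> K then coord (v i) else axis i 1)" for i
  have upd: "frame_det (v(p := x)) = det (\<chi> i. if i = p then coord x else r i)" for x
    unfolding frame_det_def r_def using assms by (intro arg_cong[of _ _ det]) (auto simp: vec_eq_iff)
  show ?thesis
  proof (rule linearI)
    fix x y :: 'a and c :: real
    show "frame_det (v(p := x + y)) = frame_det (v(p := x)) + frame_det (v(p := y))"
      unfolding upd linear_add[OF linear_coord] by (rule det_row_add)
    show "frame_det (v(p := c *\<^sub>R x)) = c *\<^sub>R frame_det (v(p := x))"
      unfolding upd linear_scale[OF linear_coord] scalar_mult_eq_scaleR[symmetric]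
      by (simp add: det_row_mul)
  qed
qed

lemma frame_det_eq_0:
  assumes "i \<in> K" "j \<in> K" "i \<noteq> j" "v i = v j"
  shows "frame_det v = 0"
  unfolding frame_det_def using assms
  by (intro det_identical_rows[OF assms(3)]) (simp add: row_def)

text \<open>This is multilinearity, applied slot by slot: the set of slots in which arbitrary group elements
are admitted grows from empty to all of \<open>K\<close>.\<close>
lemma frame_det_group_closure:
  assumes base: "\<And>v. (\<forall>i\<in>K. v i \<in> X) \<Longrightarrow> \<exists>m::int. frame_det v = of_int m * \<kappa>"
    and v: "\<forall>i\<in>K. v i \<in> group_closure X"
  shows "\<exists>m::int. frame_det v = of_int m * \<kappa>"
proof -
  have "\<exists>m::int. frame_det v = of_int m * \<kappa>"
    if "finite J" "J \<subseteq> K" "\<forall>i\<in>J. v i \<in> group_closure X" "\<forall>i\<in>K - J. v i \<in> X" for J v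
    using that
  proof (induction J arbitrary: v)
    case empty
    then show ?case using base by simp
  next
    case (insert p J)
    have p: "p \<in> K" using insert.prems by simp
    interpret L: linear "\<lambda>x. frame_det (v(p := x))" by (rule linear_frame_det[OF p])
    have "\<exists>m::int. frame_det (v(p := x)) = of_int m * \<kappa>" if "x \<in> group_closure X" for x
      using that
    proof induction
      case (base s)
      show ?case
      proof (cases "s = 0")
        case True
        show ?thesis unfolding True L.zero by (intro exI[of _ 0]) simp
      next
        case False
        then show ?thesis
          using base insert.hyps insert.prems by (intro insert.IH) auto
      qed
    next
      case (diff s t)
      then obtain m1 m2 :: int where "frame_det (v(p := s)) = of_int m1 * \<kappa>" "frame_det (v(p := t)) = of_int m2 * \<kappa>"
        by blast
      then show ?case
        unfolding L.diff by (intro exI[of _ "m1 - m2"]) (simp add: algebra_simps)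
    qed
    from this[of "v p"] show ?case using insert.prems by simp
  qed
  from this[of K] show ?thesis using v by simp
qed

text \<open>The linear map that sends the frame to the tuple \<open>v\<close> and fixes the surplus coordinates.\<close>
definition frame_map :: "('m \<Rightarrow> 'a) \<Rightarrow> real^'m::_ \<Rightarrow> real^'m::_" where
  "frame_map v y = (\<Sum>i\<in>UNIV. (y $ i) *\<^sub>R (if i \<in> K then coord (v i) else axis i 1))"

lemma linear_frame_map: "linear (frame_map v)"
  unfolding frame_map_def by (rule linearI) (simp_all add: algebra_simps sum.distrib scaleR_sum_right)

lemma det_frame_map: "det (matrix (frame_map v)) = frame_det v"
proof -
  have "frame_map v (axis j 1) = (if j \<in> K then coord (v j) else axis j 1)" for j
    unfolding frame_map_def axis_def
    by (simp add: if_distrib[of "\<lambda>x. x *\<^sub>R _"] sum.delta cong: if_cong)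
  then have "matrix (frame_map v) = transpose (\<chi> i. if i \<in> K then coord (v i) else axis i 1)"
    by (simp add: matrix_def transpose_def vec_eq_iff)
  then show ?thesis by (simp add: frame_det_def)
qed

lemma frame_map_off: "i \<notin> K \<Longrightarrow> frame_map v y $ i = y $ i"
proof -
  assume i: "i \<notin> K"
  have "frame_map v y $ i = (\<Sum>j\<in>UNIV. if j = i then y $ j else 0)"
    unfolding frame_map_def sum_component
    by (rule sum.cong) (use i in \<open>auto simp: coord_def axis_def\<close>)
  then show ?thesis by simp
qed

lemma emb_frame_map:
  assumes "\<forall>i\<in>K. v i \<in> V"
  shows "emb (frame_map v y) = (\<Sum>i\<in>K. (y $ i) *\<^sub>R v i)"
proof -
  have "emb (axis i 1) = 0" if "i \<notin> K" for i
    unfolding emb_def by (rule sum.neutral) (use that in \<open>auto simp: axis_def\<close>)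
  then have "emb (frame_map v y) = (\<Sum>i\<in>UNIV. if i \<in> K then (y $ i) *\<^sub>R v i else 0)"
    unfolding frame_map_def linear_sum[OF linear_emb] linear_scale[OF linear_emb]
    by (intro sum.cong) (use assms emb_coord in auto)
  then show ?thesis by (simp add: sum.If_cases)
qed

lemma vec_eq_frameI: "emb y = emb z \<Longrightarrow> (\<And>i. i \<notin> K \<Longrightarrow> y $ i = z $ i) \<Longrightarrow> y = z"
  unfolding vec_eq_iff by (metis emb_inner)

lemma prism_simplex:
  assumes v: "\<forall>i\<in>K. v i \<in> V"
  shows "prism (convex hull (insert 0 (v ` K))) = frame_map v ` unit_prism"
proof (intro equalityI subsetI)
  fix z assume z: "z \<in> prism (convex hull (insert 0 (v ` K)))"
  then obtain u where u: "emb z = (\<Sum>i\<in>K. u i *\<^sub>R v i)" "\<forall>i\<in>K. 0 \<le> u i" "sum u K \<le> 1"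
    unfolding prism_def convex_hull_insert_zero_image[OF finite] by blast
  define y :: "real^'m::_" where "y = (\<chi> i. if i \<in> K then u i else z $ i)"
  have "emb (frame_map v y) = emb z"
    by (simp add: emb_frame_map v u y_def)
  then have "z = frame_map v y"
    by (intro vec_eq_frameI) (simp_all add: frame_map_off y_def)
  moreover have "y \<in> unit_prism"
    using z u by (auto simp: unit_prism_def y_def prism_def)
  ultimately show "z \<in> frame_map v ` unit_prism" by blast
next
  fix z assume "z \<in> frame_map v ` unit_prism"
  then obtain y where y: "y \<in> unit_prism" "z = frame_map v y" by blast
  then show "z \<in> prism (convex hull (insert 0 (v ` K)))"
    unfolding prism_def convex_hull_insert_zero_image[OF finite]
    by (auto simp: emb_frame_map v frame_map_off unit_prism_def intro!: exI[of _ "\<lambda>i. y $ i"])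
qed

lemma measure_prism_simplex:
  assumes "\<forall>i\<in>K. v i \<in> V"
  shows "measure lebesgue (prism (convex hull (insert 0 (v ` K)))) = \<bar>frame_det v\<bar> * measure lebesgue unit_prism"
  unfolding prism_simplex[OF assms] det_frame_map[symmetric]
  by (intro measure_linear_image linear_frame_map lmeasurable_unit_prism)

lemma frame_det_nonzero:
  assumes v: "\<forall>i\<in>K. v i \<in> V" and "inj_on v K" "independent (v ` K)"
  shows "frame_det v \<noteq> 0"
proof -
  have "y = 0" if y: "frame_map v y = 0" for y
  proof (rule vec_eq_frameI)
    have "(\<Sum>i\<in>K. (y $ i) *\<^sub>R v i) = 0"
      using emb_frame_map[OF v, of y] y linear_0[OF linear_emb] by simp
    then have sum0: "(\<Sum>x\<in>v ` K. (y $ the_inv_into K v x) *\<^sub>R x) = 0"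
      using assms(2) by (simp add: sum.reindex the_inv_into_f_f)
    have "y $ i = 0" if "i \<in> K" for i
      using independentD[OF assms(3) _ subset_refl sum0, of "v i"] that assms(2)
      by (simp add: the_inv_into_f_f)
    then show "emb y = emb 0" by (simp add: emb_def)
    show "y $ i = 0 $ i" if "i \<notin> K" for i
      using frame_map_off[OF that, of v y] y by simp
  qed
  then have "inj (frame_map v)"
    using linear_injective_0[OF linear_frame_map] by blast
  then show ?thesis
    using det_nz_iff_inj[OF linear_frame_map] det_frame_map by metis
qed

text \<open>The prism over a proper subspace of \<open>V\<close> lies in a proper subspace of the whole space.\<close>
lemma negligible_prism_span:
  assumes "finite T" "T \<subseteq> V" "card T < card K"
  shows "negligible (prism (span T))"
proof (rule negligible_subset[OF negligible_lowdim])
  let ?G = "coord ` T \<union> (\<lambda>i. axis i 1) ` (- K)"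
  have "dim (span ?G) \<le> card ?G"
    unfolding dim_span using assms(1) by (intro dim_le_card') simp
  also have "\<dots> \<le> card (coord ` T) + card ((\<lambda>i. axis i (1::real)) ` (- K))"
    by (rule card_Un_le)
  also have "\<dots> \<le> card T + card (- K)"
    using assms(1) by (intro add_mono card_image_le) auto
  also have "\<dots> < card K + card (- K)" using assms(3) by simp
  also have "\<dots> = CARD('m)"
    using card_Un_disjoint[of K "- K"] by simp
  finally show "dim (span ?G) < DIM(real^'m::_)" by simp
  show "prism (span T) \<subseteq> span ?G"
  proof
    fix y assume "y \<in> prism (span T)"
    then have "coord (emb y) \<in> coord ` span T" by (auto simp: prism_def)
    then have "coord (emb y) \<in> span (coord ` T)" by (simp add: linear_span_image linear_coord)
    moreover have "span (coord ` T) \<subseteq> span ?G" by (intro span_mono) blast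
    ultimately have 1: "coord (emb y) \<in> span ?G" by (rule subsetD[rotated])
    have eq: "y = coord (emb y) + (\<Sum>i\<in>-K. (y $ i) *\<^sub>R axis i 1)"
    proof (rule vec_eq_iff[THEN iffD2], rule allI)
      fix j
      have "(\<Sum>i\<in>-K. (y $ i) *\<^sub>R axis i 1) $ j = (\<Sum>i\<in>-K. if i = j then y $ i else 0)"
        unfolding sum_component by (rule sum.cong) (auto simp: axis_def)
      then show "y $ j = (coord (emb y) + (\<Sum>i\<in>-K. (y $ i) *\<^sub>R axis i 1)) $ j"
        by (simp add: coord_emb)
    qed
    have "(\<Sum>i\<in>-K. (y $ i) *\<^sub>R axis i 1) \<in> span ?G"
      by (intro span_sum span_scale span_base) auto
    from span_add[OF 1 this] show "y \<in> span ?G" by (subst eq)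
  qed
qed

end

section \<open>Triangulating the hull of a circuit\<close>

lemma coefficients_zero:
  fixes a :: "'i \<Rightarrow> 'v::real_vector"
  assumes "finite J" "inj_on a J" "independent (a ` J)" "(\<Sum>i\<in>J. d i *\<^sub>R a i) = 0" "i \<in> J"
  shows "d i = 0"
proof -
  have "(\<Sum>x\<in>a ` J. d (the_inv_into J a x) *\<^sub>R x) = 0"
    using assms(2,4) by (simp add: sum.reindex the_inv_into_f_f)
  from independentD[OF assms(3) _ subset_refl this, of "a i"] show ?thesis
    using assms by (simp add: the_inv_into_f_f)
qed

lemma relation_multiple:
  fixes a :: "'i \<Rightarrow> 'v::real_vector"
  assumes "finite I" "inj_on a I" and c: "\<forall>i\<in>I. c i \<noteq> 0" "(\<Sum>i\<in>I. c i *\<^sub>R a i) = 0"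
    and indep: "\<forall>i\<in>I. independent (a ` (I - {i}))"
    and d: "(\<Sum>i\<in>I. d i *\<^sub>R a i) = 0"
  shows "\<exists>t. \<forall>i\<in>I. d i = t * c i"
proof (cases "I = {}")
  case False
  then obtain j where j: "j \<in> I" by blast
  define t where "t = d j / c j"
  have "(\<Sum>i\<in>I. (d i - t * c i) *\<^sub>R a i) = (\<Sum>i\<in>I. d i *\<^sub>R a i) - t *\<^sub>R (\<Sum>i\<in>I. c i *\<^sub>R a i)"
    by (simp add: scaleR_diff_left sum_subtractf scaleR_sum_right)
  also have "\<dots> = 0" using c d by simp
  finally have "(\<Sum>i\<in>I. (d i - t * c i) *\<^sub>R a i) = 0" .
  moreover have "d j - t * c j = 0" using c j by (simp add: t_def)
  ultimately have 0: "(\<Sum>i\<in>I - {j}. (d i - t * c i) *\<^sub>R a i) = 0"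
    using assms(1) j by (simp add: sum.remove[of I j])
  have "inj_on a (I - {j})" using assms(2) by (rule inj_on_subset) blast
  then have "d i - t * c i = 0" if "i \<in> I - {j}" for i
    using coefficients_zero[OF _ _ indep[rule_format, OF j] 0 that] assms(1) by simp
  with \<open>d j - t * c j = 0\<close> have "\<forall>i\<in>I. d i = t * c i" by (metis DiffI eq_iff_diff_eq_0 singletonD)
  then show ?thesis by blast
qed simp

text \<open>A relation with nonnegative coefficient sum triangulates the hull. From a representation
$x = \sum u_i a_i$ with $u \ge 0$ and $\sum u_i \le 1$ subtract as large a multiple of the relation
as nonnegativity permits: some $u_j$ with $c_j > 0$ becomes \<open>0\<close>, and the coefficient sum does not
increase. So \<open>x\<close> lies in the simplex that omits $a_j$.\<close>
lemma convex_hull_circuit: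
  fixes a :: "'i \<Rightarrow> 'v::real_vector"
  assumes fin: "finite I" "I \<noteq> {}" and c: "\<forall>i\<in>I. c i \<noteq> 0" "(\<Sum>i\<in>I. c i *\<^sub>R a i) = 0"
    and pos: "0 \<le> (sum c I :: real)"
  shows "convex hull (insert 0 (a ` I)) =
    (\<Union>j\<in>{i\<in>I. 0 < c i}. convex hull (insert 0 (a ` (I - {j}))))"
proof
  show "(\<Union>j\<in>{i\<in>I. 0 < c i}. convex hull (insert 0 (a ` (I - {j})))) \<subseteq> convex hull (insert 0 (a ` I))"
    by (intro UN_least hull_mono) auto
  show "convex hull (insert 0 (a ` I)) \<subseteq>
    (\<Union>j\<in>{i\<in>I. 0 < c i}. convex hull (insert 0 (a ` (I - {j}))))"
  proof
    fix x assume "x \<in> convex hull (insert 0 (a ` I))"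
    then obtain u where u: "x = (\<Sum>i\<in>I. u i *\<^sub>R a i)" "\<forall>i\<in>I. 0 \<le> u i" "sum u I \<le> 1"
      unfolding convex_hull_insert_zero_image[OF fin(1)] by blast
    let ?P = "{i\<in>I. 0 < c i}"
    have "?P \<noteq> {}"
    proof
      assume "?P = {}"
      then have "c i < 0" if "i \<in> I" for i using c(1) that by (metis (mono_tags, lifting) empty_Collect_eq linorder_cases)
      then have "sum c I < sum (\<lambda>_. 0) I" using fin by (intro sum_strict_mono) auto
      then show False using pos by simp
    qed
    define q where "q i = u i / c i" for i
    \<comment> \<open>The index at which subtracting the relation first exhausts a coefficient.\<close>
    have "Min (q ` ?P) \<in> q ` ?P"
      using fin \<open>?P \<noteq> {}\<close> by (intro Min_in) auto
    then obtain j where j: "j \<in> ?P" "Min (q ` ?P) = q j" by blast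
    have min: "q j \<le> q i" if "i \<in> ?P" for i
      unfolding j(2)[symmetric] using that fin by (intro Min_le) auto
    have q0: "0 \<le> q j" using j u by (simp add: q_def)
    define w where "w i = u i - q j * c i" for i
    have wj: "w j = 0" using j by (simp add: w_def q_def)
    have w0: "0 \<le> w i" if "i \<in> I" for i
    proof (cases "0 < c i")
      case True
      then have "q j \<le> u i / c i" using min[of i] that by (simp add: q_def)
      then show ?thesis using True by (simp add: w_def field_simps)
    next
      case False
      then have "q j * c i \<le> 0" using q0 by (simp add: mult_nonneg_nonpos)
      then show ?thesis using u(2) that by (force simp: w_def)
    qed
    have "sum w I = sum u I - q j * sum c I"
      by (simp add: w_def sum_subtractf sum_distrib_left)
    also have "\<dots> \<le> 1" using u(3) mult_nonneg_nonneg[OF q0 pos] by linarith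
    finally have w1: "sum w I \<le> 1" .
    have "(\<Sum>i\<in>I. w i *\<^sub>R a i) = (\<Sum>i\<in>I. u i *\<^sub>R a i) - q j *\<^sub>R (\<Sum>i\<in>I. c i *\<^sub>R a i)"
      by (simp add: w_def scaleR_diff_left sum_subtractf scaleR_sum_right)
    then have wx: "x = (\<Sum>i\<in>I. w i *\<^sub>R a i)" using u(1) c(2) by simp
    have "x = (\<Sum>i\<in>I - {j}. w i *\<^sub>R a i)" "sum w (I - {j}) \<le> 1"
      using wx w1 wj fin j by (simp_all add: sum.remove[of I j])
    then have "x \<in> convex hull (insert 0 (a ` (I - {j})))"
      unfolding convex_hull_insert_zero_image[OF finite_Diff[OF fin(1)]] using w0 by blast
    then show "x \<in> (\<Union>j\<in>?P. convex hull (insert 0 (a ` (I - {j}))))" using j by blast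
  qed
qed

text \<open>Two representations of a common point, one omitting $a_i$ and one omitting $a_j$, differ by a
multiple $t$ of the relation. Comparing signs at $i$ gives $t \le 0$ and at $j$ gives $t \ge 0$,
so they coincide and omit both vectors.\<close>
lemma simplices_overlap:
  fixes a :: "'i \<Rightarrow> 'v::real_vector"
  assumes fin: "finite I" "inj_on a I" and c: "\<forall>i\<in>I. c i \<noteq> 0" "(\<Sum>i\<in>I. c i *\<^sub>R a i) = 0"
    and indep: "\<forall>i\<in>I. independent (a ` (I - {i}))"
    and ij: "i \<in> I" "j \<in> I" "i \<noteq> j" "0 < c i" "(0::real) < c j"
  shows "convex hull (insert 0 (a ` (I - {i}))) \<inter> convex hull (insert 0 (a ` (I - {j})))
    \<subseteq> span (a ` (I - {i, j}))"
proof
  fix x assume "x \<in> convex hull (insert 0 (a ` (I - {i}))) \<inter> convex hull (insert 0 (a ` (I - {j})))"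
  then obtain u w where u: "x = (\<Sum>m\<in>I - {i}. u m *\<^sub>R a m)" "\<forall>m\<in>I - {i}. 0 \<le> u m"
    and w: "x = (\<Sum>m\<in>I - {j}. w m *\<^sub>R a m)" "\<forall>m\<in>I - {j}. 0 \<le> w m"
    unfolding convex_hull_insert_zero_image[OF finite_Diff[OF fin(1)]] by blast
  define u' where "u' = u(i := 0)"
  define w' where "w' = w(j := 0)"
  have u': "x = (\<Sum>m\<in>I. u' m *\<^sub>R a m)"
    unfolding u(1) sum.remove[OF fin(1) ij(1)] by (simp add: u'_def)
  have w': "x = (\<Sum>m\<in>I. w' m *\<^sub>R a m)"
    unfolding w(1) sum.remove[OF fin(1) ij(2)] by (simp add: w'_def)
  have "(\<Sum>m\<in>I. (u' m - w' m) *\<^sub>R a m) = 0"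
    using u' w' by (simp add: scaleR_diff_left sum_subtractf)
  from relation_multiple[OF fin c indep this]
  obtain t where t: "\<And>m. m \<in> I \<Longrightarrow> u' m - w' m = t * c m" by blast
  have "- w i = t * c i" "u j = t * c j"
    using t[OF ij(1)] t[OF ij(2)] ij(3) by (simp_all add: u'_def w'_def)
  moreover have "0 \<le> w i" "0 \<le> u j" using u(2) w(2) ij by simp_all
  ultimately have "t * c i \<le> 0" "0 \<le> t * c j" by simp_all
  then have "t = 0"
    using ij(4,5) by (metis linorder_neqE_linordered_idom mult_le_0_iff not_less zero_le_mult_iff)
  then have "u' j = 0" using t[OF ij(2)] by (simp add: w'_def)
  have "x = (\<Sum>m\<in>I - {i, j}. u' m *\<^sub>R a m)"
    unfolding u' by (rule sum.mono_neutral_right) (use fin \<open>u' j = 0\<close> in \<open>auto simp: u'_def\<close>)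
  then show "x \<in> span (a ` (I - {i, j}))"
    by (simp only:) (intro span_sum span_scale span_base imageI)
qed

section \<open>Volumes of the simplices of a circuit\<close>

context orthonormal_frame
begin

definition vol :: "'a set \<Rightarrow> real" where
  "vol X = measure lebesgue (prism (convex hull (insert 0 X)))"

lemma vol_eq_frame_det: "\<forall>i\<in>K. v i \<in> V \<Longrightarrow> vol (v ` K) = \<bar>frame_det v\<bar> * measure lebesgue unit_prism"
  unfolding vol_def by (rule measure_prism_simplex)

lemma vol_circuit:
  fixes a :: "'i \<Rightarrow> 'a"
  assumes fin: "finite I" "inj_on a I" "I \<noteq> {}" and aV: "a ` I \<subseteq> V" and card: "card I = Suc (card K)"
    and c: "\<forall>i\<in>I. c i \<noteq> 0" "(\<Sum>i\<in>I. c i *\<^sub>R a i) = 0"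
    and indep: "\<forall>i\<in>I. independent (a ` (I - {i}))" and pos: "0 \<le> (sum c I :: real)"
  shows "vol (a ` I) = (\<Sum>i\<in>{i\<in>I. 0 < c i}. vol (a ` (I - {i})))"
proof -
  let ?s = "\<lambda>i. convex hull (insert 0 (a ` (I - {i})))"
  have "prism (convex hull (insert 0 (a ` I))) = (\<Union>i\<in>{i\<in>I. 0 < c i}. prism (?s i))"
    unfolding convex_hull_circuit[OF fin(1,3) c pos] by (auto simp: prism_def)
  then have "vol (a ` I) = measure lebesgue (\<Union>((\<lambda>i. prism (?s i)) ` {i\<in>I. 0 < c i}))"
    by (simp add: vol_def)
  also have "\<dots> = (\<Sum>i\<in>{i\<in>I. 0 < c i}. measure lebesgue (prism (?s i)))"
  proof (rule measure_negligible_finite_Union_image)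
    show "prism (?s i) \<in> lmeasurable" if "i \<in> {i\<in>I. 0 < c i}" for i
      using fin(1) by (intro lmeasurable_compact compact_prism finite_imp_compact_convex_hull) simp
    show "pairwise (\<lambda>i j. negligible (prism (?s i) \<inter> prism (?s j))) {i\<in>I. 0 < c i}"
    proof (rule pairwiseI)
      fix i j assume ij: "i \<in> {i\<in>I. 0 < c i}" "j \<in> {i\<in>I. 0 < c i}" "i \<noteq> j"
      have "prism (?s i) \<inter> prism (?s j) = prism (?s i \<inter> ?s j)"
        by (auto simp: prism_def)
      also have "\<dots> \<subseteq> prism (span (a ` (I - {i, j})))"
        using simplices_overlap[OF fin(1,2) c indep, of i j] ij by (auto simp: prism_def)
      finally have sub: "prism (?s i) \<inter> prism (?s j) \<subseteq> prism (span (a ` (I - {i, j})))" .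
      have "card (a ` (I - {i, j})) \<le> card (I - {i, j})"
        using fin(1) by (intro card_image_le) simp
      also have "\<dots> = card I - 2"
        using ij fin(1) by (subst card_Diff_subset) auto
      also have "\<dots> < card K"
      proof -
        have "card {i, j} \<le> card I" using ij fin(1) by (intro card_mono) auto
        then show ?thesis using card ij(3) by simp
      qed
      finally have "negligible (prism (span (a ` (I - {i, j}))))"
        using fin(1) aV by (intro negligible_prism_span) auto
      then show "negligible (prism (?s i) \<inter> prism (?s j))" using sub by (rule negligible_subset)
    qed
  qed (use fin in auto)
  finally show ?thesis by (simp add: vol_def)
qed

text \<open>Cramer's rule: insert the relation $0 = \sum c_m a_m$ into the slot of $a_j$ in the determinant of
the vectors other than $a_i$. By multilinearity only the terms for $a_i$ and $a_j$ survive, the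
others having a repeated row.\<close>
lemma vol_facet_ratio:
  fixes a :: "'i \<Rightarrow> 'a"
  assumes fin: "finite I" and aV: "a ` I \<subseteq> V" and card: "card I = Suc (card K)"
    and c: "(\<Sum>i\<in>I. c i *\<^sub>R a i) = 0" and ij: "i \<in> I" "j \<in> I"
  shows "\<bar>c j\<bar> * vol (a ` (I - {i})) = \<bar>c i\<bar> * vol (a ` (I - {j}))"
proof (cases "i = j")
  case False
  have "card K = card (I - {i})" using fin card ij by simp
  then obtain s where s: "bij_betw s K (I - {i})"
    using fin by (metis finite finite_Diff finite_same_card_bij)
  then obtain p where p: "p \<in> K" "s p = j"
    using ij False by (metis DiffI bij_betw_iff_bijections singletonD)
  define v where "v = a \<circ> s"
  interpret L: linear "\<lambda>x. frame_det (v(p := x))" by (rule linear_frame_det[OF p(1)])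
  have 0: "frame_det (v(p := a m)) = 0" if m: "m \<in> I - {i} - {j}" for m
  proof -
    obtain r where "r \<in> K" "s r = m" "r \<noteq> p"
      using s m p by (metis DiffD1 DiffD2 bij_betw_iff_bijections insertI1)
    then show ?thesis by (intro frame_det_eq_0[of p r]) (use p in \<open>auto simp: v_def\<close>)
  qed
  have "0 = frame_det (v(p := \<Sum>m\<in>I. c m *\<^sub>R a m))" unfolding c L.zero by simp
  also have "\<dots> = (\<Sum>m\<in>I. c m * frame_det (v(p := a m)))"
    unfolding L.sum L.scale by simp
  also have "\<dots> = c i * frame_det (v(p := a i)) + (c j * frame_det (v(p := a j)) +
      (\<Sum>m\<in>I - {i} - {j}. c m * frame_det (v(p := a m))))"
    using fin ij False by (subst sum.remove[of _ i], simp, simp, subst sum.remove[of _ j]) auto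
  also have "(\<Sum>m\<in>I - {i} - {j}. c m * frame_det (v(p := a m))) = 0"
    using 0 by (intro sum.neutral) simp
  also have "v(p := a j) = v" using p by (auto simp: v_def)
  finally have "c j * frame_det v = - (c i * frame_det (v(p := a i)))" by linarith
  then have dets: "\<bar>c j\<bar> * \<bar>frame_det v\<bar> = \<bar>c i\<bar> * \<bar>frame_det (v(p := a i))\<bar>"
    by (metis abs_minus_cancel abs_mult)
  have img: "s ` K = I - {i}" "inj_on s K" using s by (auto simp: bij_betw_def)
  have v1: "v ` K = a ` (I - {i})" unfolding v_def image_comp[symmetric] img(1) ..
  have "v(p := a i) ` K = insert (a i) (a ` s ` (K - {p}))"
    using p by (auto simp: v_def)
  also have "s ` (K - {p}) = I - {i} - {j}"
    using inj_on_image_set_diff[OF img(2), of K "{p}"] img p by simp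
  also have "insert (a i) (a ` (I - {i} - {j})) = a ` (I - {j})"
    using ij False by auto
  finally have v2: "v(p := a i) ` K = a ` (I - {j})" .
  have V1: "\<forall>m\<in>K. v m \<in> V"
    using v1 aV by blast
  have V2: "\<forall>m\<in>K. (v(p := a i)) m \<in> V"
    using V1 aV ij by auto
  show ?thesis
    using dets vol_eq_frame_det[OF V1] vol_eq_frame_det[OF V2] unfolding v1 v2
    by (metis mult.assoc)
qed simp

text \<open>This replaces the index formula for sublattices. Let \<open>\<kappa>'\<close> and \<open>\<delta>\<close> be \<open>\<kappa>\<close> and \<open>vol B\<close> in units of
the volume of \<open>unit_prism\<close>. Each determinant of a tuple of generators is \<open>0\<close> or $\pm c_i \kappa'$,
and each determinant of a tuple of basis vectors is \<open>0\<close> or $\pm\delta$. Expanding either kind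
multilinearly in terms of the other shows that \<open>\<delta>\<close> is an integer multiple of \<open>\<kappa>'\<close>, and every $c_i \kappa'$ is an integer multiple of \<open>\<delta>\<close>. Coprimality of the $c_i$ makes
\<open>\<kappa>'\<close> itself a multiple of \<open>\<delta>\<close>, so the two nonnegative numbers agree.\<close>
lemma vol_lattice_basis:
  fixes a :: "'i \<Rightarrow> 'a" and c :: "'i \<Rightarrow> int"
  assumes fin: "finite I" and aV: "a ` I \<subseteq> V" and card: "card I = Suc (card K)"
    and inj_a: "inj_on a I"
    and c: "Gcd (c ` I) = 1" and \<kappa>: "\<forall>i\<in>I. vol (a ` (I - {i})) = \<bar>of_int (c i)\<bar> * \<kappa>" "0 \<le> \<kappa>"
    and B: "finite B" "independent B" "span B = V" "group_closure B = group_closure (a ` I)"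
  shows "vol B = \<kappa>" and "0 < vol B"
proof -
  let ?m = "measure lebesgue unit_prism"
  have m: "0 < ?m" by (rule unit_prism_pos)
  have BV: "B \<subseteq> V" using B(3) span_superset by blast
  have cardB: "card B = card K"
    using dim_V B(2,3) by (metis dim_span_eq_card_independent dim_span)
  obtain s where s: "bij_betw s K B"
    using cardB B(1) by (metis finite finite_same_card_bij)
  then have sB: "s ` K = B" "inj_on s K" by (auto simp: bij_betw_def)
  have sV: "\<forall>i\<in>K. s i \<in> V" using sB(1) BV by blast
  have volB: "vol B = \<bar>frame_det s\<bar> * ?m" using vol_eq_frame_det[OF sV] sB(1) by simp
  have "frame_det s \<noteq> 0" using frame_det_nonzero[OF sV sB(2)] B(2) sB(1) by simp
  then show pos: "0 < vol B" using volB m by simp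
  define \<delta> where "\<delta> = vol B / ?m"
  have \<delta>: "\<delta> = \<bar>frame_det s\<bar>" "0 < \<delta>" using volB \<open>frame_det s \<noteq> 0\<close> m by (simp_all add: \<delta>_def)
  define \<kappa>' where "\<kappa>' = \<kappa> / ?m"
  have pm: "\<exists>k::int. x = of_int k * z" if "\<bar>x\<bar> = \<bar>of_int y\<bar> * z" for x z :: real and y :: int
  proof (cases "0 \<le> x")
    case True
    then show ?thesis using that by (intro exI[of _ "\<bar>y\<bar>"]) simp
  next
    case False
    then show ?thesis using that by (intro exI[of _ "- \<bar>y\<bar>"]) simp
  qed
  have DA: "\<exists>k::int. frame_det v = of_int k * \<kappa>'" if v: "\<forall>i\<in>K. v i \<in> a ` I" for v
  proof (cases "inj_on v K")
    case False
    then obtain i j where "i \<in> K" "j \<in> K" "i \<noteq> j" "v i = v j" by (auto simp: inj_on_def)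
    then have "frame_det v = 0" by (rule frame_det_eq_0)
    then show ?thesis by (intro exI[of _ 0]) simp
  next
    case True
    define J where "J = {i\<in>I. a i \<in> v ` K}"
    have J: "a ` J = v ` K" "J \<subseteq> I" using v unfolding J_def by force+
    have "card J = card K"
      using J True inj_on_subset[OF inj_a J(2)] by (metis card_image)
    then have "card (I - J) = 1"
      using card J(2) fin by (subst card_Diff_subset) (auto intro: finite_subset)
    then obtain i where "I - J = {i}" by (auto simp: card_1_singleton_iff)
    then have i: "i \<in> I" "J = I - {i}" using J(2) by auto
    have "\<bar>frame_det v\<bar> * ?m = \<bar>of_int (c i)\<bar> * \<kappa>"
      using vol_eq_frame_det[of v] v aV \<kappa>(1) i J(1) by (metis image_subset_iff subsetD)
    then have "\<bar>frame_det v\<bar> = \<bar>of_int (c i)\<bar> * \<kappa>'" using m by (simp add: \<kappa>'_def field_simps)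
    then show ?thesis by (rule pm)
  qed
  have DB: "\<exists>k::int. frame_det v = of_int k * \<delta>" if v: "\<forall>i\<in>K. v i \<in> B" for v
  proof (cases "inj_on v K")
    case False
    then obtain i j where "i \<in> K" "j \<in> K" "i \<noteq> j" "v i = v j" by (auto simp: inj_on_def)
    then have "frame_det v = 0" by (rule frame_det_eq_0)
    then show ?thesis by (intro exI[of _ 0]) simp
  next
    case True
    have "v ` K = B"
      using v True cardB B(1) by (intro card_subset_eq) (auto simp: card_image)
    then have "vol B = \<bar>frame_det v\<bar> * ?m" using vol_eq_frame_det[of v] v BV by auto
    then have "\<bar>frame_det v\<bar> = \<bar>of_int 1\<bar> * \<delta>" using m by (simp add: \<delta>_def)
    then show ?thesis by (rule pm)
  qed
  have "\<exists>k::int. frame_det s = of_int k * \<kappa>'"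
  proof (rule frame_det_group_closure[OF DA])
    show "\<forall>i\<in>K. s i \<in> group_closure (a ` I)"
      using sB(1) unfolding B(4)[symmetric] by (auto intro: subsetD[OF subset_group_closure])
  qed
  then obtain k1 :: int where "frame_det s = of_int k1 * \<kappa>'" by blast
  then have k1: "\<delta> = of_int \<bar>k1\<bar> * \<kappa>'"
    using \<delta>(1) \<kappa>(2) m by (simp add: abs_mult \<kappa>'_def)
  have "\<exists>k::int. of_int x * \<kappa>' = of_int k * \<delta>" if "x \<in> group_closure (c ` I)" for x
    using that
  proof induction
    case (base x)
    show ?case
    proof (cases "x = 0")
      case True
      then show ?thesis by (intro exI[of _ 0]) simp
    next
      case False
      then obtain i where i: "i \<in> I" "x = c i" using base by blast
      have "card K = card (I - {i})" using fin card i by simp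
      then obtain r where r: "bij_betw r K (I - {i})"
        using fin by (metis finite finite_Diff finite_same_card_bij)
      define v where "v = a \<circ> r"
      have v: "v ` K = a ` (I - {i})" 
        unfolding v_def image_comp[symmetric] bij_betw_imp_surj_on[OF r] ..
      then have vI: "\<forall>i\<in>K. v i \<in> a ` I" by blast
      have "\<bar>frame_det v\<bar> * ?m = \<bar>of_int (c i)\<bar> * \<kappa>"
        using vol_eq_frame_det[of v] vI aV \<kappa>(1) i v by (metis image_subset_iff subsetD)
      then have 1: "\<bar>frame_det v\<bar> = \<bar>of_int x\<bar> * \<kappa>'" using m i by (simp add: \<kappa>'_def field_simps)
      have "\<exists>k::int. frame_det v = of_int k * \<delta>"
      proof (rule frame_det_group_closure[OF DB])
        show "\<forall>i\<in>K. v i \<in> group_closure B"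
          unfolding B(4) using vI by (intro ballI subsetD[OF subset_group_closure]) blast
      qed
      then obtain k :: int where "frame_det v = of_int k * \<delta>" by blast
      then have "\<bar>of_int x * \<kappa>'\<bar> = \<bar>of_int k\<bar> * \<delta>"
        using 1 \<delta>(2) \<kappa>(2) m by (simp add: abs_mult \<kappa>'_def)
      then show ?thesis by (rule pm)
    qed
  next
    case (diff x y)
    then obtain k k' :: int where "of_int x * \<kappa>' = of_int k * \<delta>" "of_int y * \<kappa>' = of_int k' * \<delta>"
      by blast
    then show ?case by (intro exI[of _ "k - k'"]) (simp add: algebra_simps)
  qed
  from this[of 1] Gcd_in_group_closure[of "c ` I"]
  obtain k2 :: int where k2: "\<kappa>' = of_int k2 * \<delta>" unfolding c by auto
  have "of_int (\<bar>k1\<bar> * k2) * \<delta> = 1 * \<delta>"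
    using k1 unfolding k2 by (simp only: of_int_mult mult.assoc mult_1)
  then have "real_of_int (\<bar>k1\<bar> * k2) = 1"
    using \<delta>(2) by (simp only: mult_cancel_right) simp
  then have "\<bar>k1\<bar> * k2 = 1" by (simp only: of_int_eq_1_iff)
  then have "\<bar>k1\<bar> = 1" using abs_zmult_eq_1[of "\<bar>k1\<bar>" k2] by simp
  then have "\<delta> = \<kappa>'" using k1 by simp
  then show "vol B = \<kappa>" using m by (simp add: \<delta>_def \<kappa>'_def)
qed

end

text \<open>The type \<open>'d bit0\<close> serves as a well-ordered finite type with at least \<open>CARD('d)\<close> elements; \<open>'d\<close>
itself carries no order.\<close>
lemma orthonormal_frame_exists:
  fixes V :: "(real^'d) set"
  assumes "subspace V"
  shows "\<exists>(K :: 'd bit0 set) e. orthonormal_frame V K e \<and> e ` K = (SOME B. orthonormal_basis_of V B)"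
proof -
  define B where "B = (SOME B. orthonormal_basis_of V B)"
  have B: "orthonormal_basis_of V B"
    unfolding B_def using someI_ex[OF orthonormal_basis_of_exists[OF assms]] .
  then have "independent B"
    unfolding orthonormal_basis_of_def by (intro pairwise_orthogonal_independent) auto
  then have finB: "finite B" and "card B \<le> CARD('d)"
    using independent_bound by fastforce+
  then have "card B \<le> CARD('d bit0)" by simp
  then obtain K :: "'d bit0 set" where "card K = card B"
    by (metis obtain_subset_with_card_n)
  then obtain e where "bij_betw e K B"
    using finB by (metis finite finite_same_card_bij)
  then have "inj_on e K" "e ` K = B" by (auto simp: bij_betw_def)
  then show ?thesis
    using B unfolding B_def[symmetric] by (intro exI[of _ K] exI[of _ e]) (simp add: orthonormal_frame_def)
qed

section \<open>The normalized volume of a circuit\<close>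

text \<open>The two sides of the relation are interchanged by replacing \<open>c\<close> with \<open>-c\<close>; the sign condition on
the sum says that the positive side is the larger one.\<close>
lemma normalized_vol_circuit:
  fixes a :: "'i \<Rightarrow> real^'d" and c :: "'i \<Rightarrow> int"
  assumes fin: "finite I" "I \<noteq> {}" and inj_a: "inj_on a I"
    and int: "\<forall>i\<in>I. \<forall>j. a i $ j \<in> \<int>"
    and dim: "Suc (dim (span (a ` I))) = card I"
    and indep: "\<forall>i\<in>I. independent (a ` (I - {i}))"
    and c: "\<forall>i\<in>I. c i \<noteq> 0" "Gcd (c ` I) = 1" "(\<Sum>i\<in>I. of_int (c i) *\<^sub>R a i) = 0"
    and pos: "0 \<le> sum c I"
  shows "normalized_vol (a ` I) = of_int (\<Sum>i\<in>{i\<in>I. 0 < c i}. c i)"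
proof -
  define V where "V = span (a ` I)"
  have aV: "a ` I \<subseteq> V" unfolding V_def by (rule span_superset)
  let ?L = "group_closure (a ` I)"
  obtain B0 where B0: "finite B0" "card B0 < card I" "group_closure B0 = ?L"
    using fewer_generators[OF fin(1) c(2,3)] by blast
  have "span B0 = V" using B0(3) span_group_closure V_def by metis
  then have "independent B0"
    using B0(1,2) dim
    by (intro card_le_dim_spanning[of _ V]) (auto simp: V_def[symmetric] span_base)
  then have "\<exists>B. lattice_basis ?L B"
    using independent_imp_lattice_basis[of B0] B0 by auto
  define B where "B = (SOME B. lattice_basis ?L B)"
  have B: "lattice_basis ?L B"
    unfolding B_def by (rule someI_ex) fact
  then have finB: "finite B" and clB: "group_closure B = ?L"
    by (auto simp: lattice_basis_def)
  have intL: "x $ j \<in> \<int>" if "x \<in> ?L" for x j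
    using that by induction (use int in auto)
  have "independent B"
    using subset_group_closure[of B] clB intL by (intro lattice_basis_independent[OF B]) blast
  have spanB: "span B = V" using clB span_group_closure V_def by metis
  obtain K :: "'d bit0 set" and e where Ke: "orthonormal_frame V K e"
    and eK: "e ` K = (SOME B. orthonormal_basis_of V B)"
    using orthonormal_frame_exists[of V] unfolding V_def by (metis subspace_span)
  interpret orthonormal_frame V K e by (rule Ke)
  have cardK: "card I = Suc (card K)" using dim dim_V unfolding V_def by simp
  have meas: "measure (subspace_lborel V) (convex hull (insert 0 X)) = vol X" if "finite X" for X
    using that unfolding vol_def
    by (intro subspace_measure_prism[OF eK] finite_imp_compact_convex_hull) simp
  let ?c = "\<lambda>i. real_of_int (c i)"
  obtain i0 where i0: "i0 \<in> I" using fin(2) by blast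
  define \<kappa> where "\<kappa> = vol (a ` (I - {i0})) / \<bar>?c i0\<bar>"
  have \<kappa>: "vol (a ` (I - {i})) = \<bar>?c i\<bar> * \<kappa>" if "i \<in> I" for i
  proof -
    have "\<bar>?c i0\<bar> * vol (a ` (I - {i})) = \<bar>?c i\<bar> * vol (a ` (I - {i0}))"
      by (rule vol_facet_ratio[OF fin(1) aV cardK c(3) that i0])
    then show ?thesis using c(1) i0 by (simp add: \<kappa>_def field_simps)
  qed
  have "0 \<le> \<kappa>" by (simp add: \<kappa>_def vol_def)
  have volB: "vol B = \<kappa>" "0 < vol B"
    using vol_lattice_basis[OF fin(1) aV cardK inj_a c(2) _ \<open>0 \<le> \<kappa>\<close> finB \<open>independent B\<close> spanB clB] \<kappa>
    by blast+
  have "0 \<le> real_of_int (sum c I)" using pos by (simp only: of_int_0_le_iff)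
  then have "vol (a ` I) = (\<Sum>i\<in>{i\<in>I. 0 < ?c i}. vol (a ` (I - {i})))"
    using c(1) by (intro vol_circuit fin inj_a aV cardK c(3) indep) simp_all
  also have "\<dots> = (\<Sum>i\<in>{i\<in>I. 0 < c i}. ?c i * \<kappa>)"
    by (rule sum.cong) (auto simp: \<kappa>)
  also have "\<dots> = of_int (\<Sum>i\<in>{i\<in>I. 0 < c i}. c i) * \<kappa>"
    by (simp add: sum_distrib_right)
  finally show ?thesis
    unfolding normalized_vol_def V_def[symmetric] B_def[symmetric]
    using meas[OF finB] meas[of "a ` I"] fin(1) volB by simp
qed

theorem mainTheorem1:
  fixes a :: "nat \<Rightarrow> real ^ 'd"
    and l :: "nat \<Rightarrow> nat"
    and n k :: nat
    and A :: "(real ^ 'd) set"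
  assumes A_def: "A = a ` {1..n}"
    and distinct: "inj_on a {1..n}"
    and integral: "\<forall>i\<in>{1..n}. \<forall>j. a i $ j \<in> \<int>"
    and k_bounds: "1 \<le> k" "k \<le> n"
    and dim_span: "dim (span A) = n - 1"
    and indep: "\<forall>S\<subseteq>A. card S = n - 1 \<longrightarrow> independent S"
    and l_pos: "\<forall>i\<in>{1..n}. 0 < l i"
    and l_coprime: "Gcd (l ` {1..n}) = 1"
    and relation:
      "(\<Sum>i=1..k. real (l i) *\<^sub>R a i) - (\<Sum>j=k+1..n. real (l j) *\<^sub>R a j) = 0"
    and generates:
      "\<forall>c :: nat \<Rightarrow> int. (\<Sum>i=1..n. of_int (c i) *\<^sub>R a i) = 0 \<longrightarrow>
         (\<exists>m :: int. \<forall>i\<in>{1..n}. c i = m * (if i \<le> k then int (l i) else - int (l i)))"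
  shows "normalized_vol A = real (max (\<Sum>i=1..k. l i) (\<Sum>j=k+1..n. l j))"
proof -
  let ?I = "{1..n}"
  have indep': "\<forall>i\<in>?I. independent (a ` (?I - {i}))"
  proof
    fix i assume i: "i \<in> ?I"
    have "inj_on a (?I - {i})" using distinct by (rule inj_on_subset) blast
    then have "card (a ` (?I - {i})) = n - 1" using i by (simp add: card_image)
    moreover have "a ` (?I - {i}) \<subseteq> A" unfolding A_def by blast
    ultimately show "independent (a ` (?I - {i}))" using indep by blast
  qed
  have dim': "Suc (dim (span (a ` ?I))) = card ?I"
    using dim_span k_bounds unfolding A_def by simp
  define c where "c i = (if i \<le> k then int (l i) else - int (l i))" for i
  have split: "{1..n} = {1..k} \<union> {k+1..n}" "{1..k} \<inter> {k+1..n} = {}"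
    using k_bounds by auto
  have rel: "(\<Sum>i\<in>?I. of_int (c i) *\<^sub>R a i) = 0"
    using relation unfolding split(1)
    by (subst sum.union_disjoint) (auto simp: c_def sum_negf cong: sum.cong_simp)
  have sumc: "sum c ?I = int (\<Sum>i=1..k. l i) - int (\<Sum>j=k+1..n. l j)"
    unfolding split(1)
    by (subst sum.union_disjoint) (auto simp: c_def sum_negf cong: sum.cong_simp)
  have gcd: "Gcd (f ` ?I) = 1" if f: "\<And>i. \<bar>f i\<bar> = int (l i)" for f :: "nat \<Rightarrow> int"
  proof -
    have "nat (Gcd (f ` ?I)) dvd Gcd (l ` ?I)"
    proof (rule Gcd_greatest)
      fix x assume "x \<in> l ` ?I"
      then obtain i where i: "i \<in> ?I" "x = l i" by blast
      then have "Gcd (f ` ?I) dvd f i" by (intro Gcd_dvd) blast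
      then have "Gcd (f ` ?I) dvd int x" using f[of i] i(2) by (metis dvd_abs_iff)
      then show "nat (Gcd (f ` ?I)) dvd x" by (simp add: nat_dvd_iff)
    qed
    then show ?thesis using l_coprime by simp
  qed
  have nonempty: "?I \<noteq> {}" using k_bounds by simp
  show ?thesis
  proof (cases "(\<Sum>j=k+1..n. l j) \<le> (\<Sum>i=1..k. l i)")
    case True
    then have "0 \<le> sum c ?I" unfolding sumc by linarith
    then have "normalized_vol A = of_int (\<Sum>i\<in>{i\<in>?I. 0 < c i}. c i)"
      unfolding A_def using l_pos
      by (intro normalized_vol_circuit distinct integral dim' indep' rel gcd nonempty)
        (auto simp: c_def)
    also have "{i\<in>?I. 0 < c i} = {1..k}"
      using l_pos k_bounds by (auto simp: c_def split: if_splits)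
    also have "(\<Sum>i=1..k. c i) = int (\<Sum>i=1..k. l i)"
      by (simp add: c_def)
    finally show ?thesis using True by simp
  next
    case False
    have "(\<Sum>i\<in>?I. of_int (- c i) *\<^sub>R a i) = 0"
      using rel by (simp add: sum_negf)
    moreover have "0 \<le> (\<Sum>i\<in>?I. - c i)" using False sumc unfolding sum_negf by linarith
    ultimately have "normalized_vol A = of_int (\<Sum>i\<in>{i\<in>?I. 0 < - c i}. - c i)"
      unfolding A_def using l_pos
      by (intro normalized_vol_circuit distinct integral dim' indep' gcd nonempty)
        (auto simp: c_def)
    also have "{i\<in>?I. 0 < - c i} = {k+1..n}"
      using l_pos by (auto simp: c_def split: if_splits)
    also have "(\<Sum>i=k+1..n. - c i) = int (\<Sum>i=k+1..n. l i)"
      by (simp add: c_def)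
    finally show ?thesis using False by simp
  qed
qed

end
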